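(* Let $1<\alpha<2$, let $X$ be a complex Banach space and let $u:\mathbb{N}_0\to X$ be any sequence. Then for every $n\in\mathbb{N}_0$, $${}_C\Delta^{\alpha}u(n)=\Delta^{\alpha}u(n)-k^{2-\alpha}(n+1)\,[u(1)-2u(0)]-k^{2-\alpha}(n+2)\,u(0).$$
   Context: $\mathbb{N}_0=\{0,1,2,\dots\}$. For $\beta>0$ and $n\in\mathbb{N}_0$, $k^{\beta}(n):=\frac{\Gamma(\beta+n)}{\Gamma(\beta)\Gamma(n+1)}$. For a sequence $u:\mathbb{N}_0\to X$, $\Delta u(n):=u(n+1)-u(n)$ and $\Delta^2:=\Delta\circ\Delta$. For $\beta>0$ the $\beta$-th fractional sum of $u$ is $\Delta^{-\beta}u(n):=\sum_{j=0}^n k^{\beta}(n-j)u(j)$, $n\in\mathbb{N}_0$. For $1<\alpha<2$, the Riemann-Liouville fractional difference is $\Delta^{\alpha}u(n):=\Delta^2(\Delta^{-(2-\alpha)}u)(n)$, and the Caputo fractional difference is ${}_C\Delta^{\alpha}u(n):=\Delta^{-(2-\alpha)}(\Delta^2u)(n)$. *)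

theory Defs
  imports "HOL-Analysis.Analysis"
begin

text \<open>
  The libraries only provide real Banach spaces. As in the usual extension of that hierarchy, a
  complex Banach space is a complete normed space with a complex scalar multiplication which is
  compatible with the norm and whose restriction to the reals is the existing scalar multiplication.
\<close>

class complex_banach = banach +
  fixes scaleC :: "complex \<Rightarrow> 'a \<Rightarrow> 'a"  (infixr \<open>*\<^sub>C\<close> 75)
  assumes scaleC_add_right: "a *\<^sub>C (x + y) = a *\<^sub>C x + a *\<^sub>C y"
    and scaleC_add_left: "(a + b) *\<^sub>C x = a *\<^sub>C x + b *\<^sub>C x"
    and scaleC_scaleC: "a *\<^sub>C (b *\<^sub>C x) = (a * b) *\<^sub>C x"
    and scaleC_one: "1 *\<^sub>C x = x"
    and scaleR_scaleC: "r *\<^sub>R x = complex_of_real r *\<^sub>C x"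
    and norm_scaleC: "norm (a *\<^sub>C x) = cmod a * norm x"

instantiation complex :: complex_banach
begin

definition scaleC_complex :: "complex \<Rightarrow> complex \<Rightarrow> complex" where
  "scaleC_complex a x = a * x"

instance
  by standard (simp_all add: scaleC_complex_def algebra_simps scaleR_conv_of_real norm_mult)

end

definition kern :: "real \<Rightarrow> nat \<Rightarrow> real" where
  "kern \<beta> n = Gamma (\<beta> + real n) / (Gamma \<beta> * Gamma (real n + 1))"

definition fdiff :: "(nat \<Rightarrow> 'a::ab_group_add) \<Rightarrow> nat \<Rightarrow> 'a" where
  "fdiff u n = u (n + 1) - u n"

definition frac_sum :: "real \<Rightarrow> (nat \<Rightarrow> 'a::real_vector) \<Rightarrow> nat \<Rightarrow> 'a" where
  "frac_sum \<beta> u n = (\<Sum>j = 0..n. kern \<beta> (n - j) *\<^sub>R u j)"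

text \<open>The two fractional differences below are meant for orders strictly between 1 and 2.\<close>

definition RL_diff :: "real \<Rightarrow> (nat \<Rightarrow> 'a::real_vector) \<Rightarrow> nat \<Rightarrow> 'a" where
  "RL_diff \<alpha> u = (fdiff \<circ> fdiff) (frac_sum (2 - \<alpha>) u)"

definition Caputo_diff :: "real \<Rightarrow> (nat \<Rightarrow> 'a::real_vector) \<Rightarrow> nat \<Rightarrow> 'a" where
  "Caputo_diff \<alpha> u = frac_sum (2 - \<alpha>) ((fdiff \<circ> fdiff) u)"

end

theory Submission
  imports Defs
begin

text \<open>
  The fractional sum is a convolution with a kernel, and the difference operator commutes with
  such a convolution up to a boundary term: shifting the convolution can be done by shifting
  \<open>u\<close>, at the price of the one summand that contains the initial value \<open>u 0\<close>
  (\<open>fdiff_frac_sum\<close>). Commuting both differences past the convolution turns the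
  Riemann-Liouville difference into the Caputo difference and leaves two boundary terms. The outer
  commutation, applied to the sequence of first differences, leaves
  \<open>kern \<beta> (n + 1)\<close> times \<open>u 1 - u 0\<close>. The inner boundary term is itself a sequence in
  \<open>n\<close>, and its difference is \<open>kern \<beta> (n + 2) - kern \<beta> (n + 1)\<close> times
  \<open>u 0\<close>. Collecting the coefficients of the kernel values gives the formula.
\<close>

text \<open>
  Splitting off \<open>j = 0\<close> rather than the last summand keeps the kernel argument \<open>n - j\<close>
  intact, so that what remains is again a fractional sum, of the shifted sequence.
\<close>

lemma frac_sum_Suc:
  "frac_sum \<beta> u (Suc n) = frac_sum \<beta> (\<lambda>j. u (Suc j)) n + kern \<beta> (Suc n) *\<^sub>R u 0"
  unfolding frac_sum_def by (subst sum.atLeast0_atMost_Suc_shift) (simp add: add.commute)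

lemma fdiff_frac_sum:
  "fdiff (frac_sum \<beta> u) n = frac_sum \<beta> (fdiff u) n + kern \<beta> (n + 1) *\<^sub>R u 0"
proof -
  have "frac_sum \<beta> (\<lambda>j. u (Suc j)) n - frac_sum \<beta> u n = frac_sum \<beta> (fdiff u) n"
    by (simp add: frac_sum_def fdiff_def scaleR_diff_right sum_subtractf)
  then show ?thesis
    by (simp add: fdiff_def[of "frac_sum \<beta> u"] frac_sum_Suc algebra_simps)
qed

lemma fdiff_fdiff_frac_sum:
  "fdiff (fdiff (frac_sum \<beta> u)) n = frac_sum \<beta> (fdiff (fdiff u)) n
     + kern \<beta> (n + 1) *\<^sub>R (u 1 - 2 *\<^sub>R u 0) + kern \<beta> (n + 2) *\<^sub>R u 0"
proof -
  have "fdiff (fdiff (frac_sum \<beta> u)) n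
      = fdiff (frac_sum \<beta> (fdiff u)) n + (kern \<beta> (n + 2) - kern \<beta> (n + 1)) *\<^sub>R u 0"
    unfolding fdiff_def[of "fdiff (frac_sum \<beta> u)"] fdiff_def[of "frac_sum \<beta> (fdiff u)"]
    by (simp add: fdiff_frac_sum algebra_simps)
  also have "fdiff (frac_sum \<beta> (fdiff u)) n
      = frac_sum \<beta> (fdiff (fdiff u)) n + kern \<beta> (n + 1) *\<^sub>R (u 1 - u 0)"
    by (simp add: fdiff_frac_sum fdiff_def[of u 0])
  finally show ?thesis
    by (simp add: algebra_simps scaleR_2)
qed

theorem theorem2p5:
  fixes \<alpha> :: real and u :: "nat \<Rightarrow> 'a::complex_banach" and n :: nat
  assumes "1 < \<alpha>" and "\<alpha> < 2"
  shows "Caputo_diff \<alpha> u n =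
    RL_diff \<alpha> u n - kern (2 - \<alpha>) (n + 1) *\<^sub>R (u 1 - 2 *\<^sub>R u 0) - kern (2 - \<alpha>) (n + 2) *\<^sub>R u 0"
  by (simp add: Caputo_diff_def RL_diff_def fdiff_fdiff_frac_sum)

end
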